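(* Let $\mathcal{X}$ be a finite field, let $p_X,p_K\in\mathcal{P}(\mathcal{X})$, and let $\delta_0>0$. Suppose $H(X)<H(K)$. Then $R^{\star}(p_X,p_K)=R^{\ast}(p_X,p_K)=H(X)$, and for every $\delta\in(0,\delta_0]$, $$R_{\mathrm{v,inf}}(p_X,p_K)=R_{\mathrm{v,inf}}(\delta|p_X,p_K)=H(X).$$
   Context: All logarithms are to base 2 and $\mathbb{N}=\{1,2,\ldots\}$. $\mathcal{P}(\mathcal{X})$ is the set of probability distributions on $\mathcal{X}$; $H(X)$ and $H(K)$ are the Shannon entropies of $p_X$ and $p_K$; $I(\cdot;\cdot)$ is mutual information. Source and key: $\boldsymbol{X}=X_1\cdots X_n$ is i.i.d. with law $p_X$, $\boldsymbol{K}=K_1\cdots K_n$ is i.i.d. with law $p_K$, and $\boldsymbol{X}$ and $\boldsymbol{K}$ are independent. Scheme: let $\mathcal{Y}=\{0,1\}$ and $\mathcal{Y}^*=\bigcup_{l\in\mathbb{N}}\mathcal{Y}^l$, and let $|y|$ be the length of $y\in\mathcal{Y}^*$. A variable-length source encryption scheme of block length $n$ is a pair of maps $\Phi^{(n)}:\mathcal{X}^n\times\mathcal{X}^n\to\mathcal{Y}^*$, $\Psi^{(n)}:\mathcal{X}^n\times\mathcal{Y}^*\to\mathcal{X}^n$, written $\Phi_{\boldsymbol{k}}^{(n)}(\boldsymbol{x})=\Phi^{(n)}(\boldsymbol{k},\boldsymbol{x})$ and $\Psi_{\boldsymbol{k}}^{(n)}(c)=\Psi^{(n)}(\boldsymbol{k},c)$,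 with $\Psi_{\boldsymbol{k}}^{(n)}(\Phi_{\boldsymbol{k}}^{(n)}(\boldsymbol{x}))=\boldsymbol{x}$ for all $\boldsymbol{k},\boldsymbol{x}\in\mathcal{X}^n$. The ciphertext is $C^{(n)}=\Phi_{\boldsymbol{K}}^{(n)}(\boldsymbol{X})$, and the average codeword length is $\overline{L}_{\Phi^{(n)}}=\mathrm{E}\left[|\Phi_{\boldsymbol{K}}^{(n)}(\boldsymbol{X})|\right]$. Admissible rates: for $\delta\in(0,\delta_0]$, a real number $R$ is $\delta$-admissible (for $(p_X,p_K)$) if there exists a sequence of schemes $\{(\Phi^{(n)},\Psi^{(n)})\}_{n=1}^\infty$ such that for every $\gamma>0$ there is $n_0=n_0(\gamma)\in\mathbb{N}$ such that for all $n\ge n_0$: $\frac1n\overline{L}_{\Phi^{(n)}}\le R+\gamma$ and $I(C^{(n)};\boldsymbol{X})\le\delta$. $R_{\mathrm{v,inf}}(\delta|p_X,p_K)$ is the infimum of all $\delta$-admissible $R$ (with $\inf\emptyset=+\infty$), and $R_{\mathrm{v,inf}}(p_X,p_K)=\sup_{\delta\in(0,\delta_0]}R_{\mathrm{v,inf}}(\delta|p_X,p_K)$. $R^{\ast}(p_X,p_K)$ equals $H(X)$ if $H(X)<H(K)$ and $+\infty$ otherwise; $R^{\star}(p_X,p_K)$ equals $H(X)$ if $H(X)\le H(K)$ and $+\infty$ otherwise. *)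

theory Defs
  imports "HOL-Probability.Probability"
begin

definition shannon_entropy :: "'a::finite pmf \<Rightarrow> real" where
  "shannon_entropy p =
     prob_space.entropy (measure_pmf p) 2 (count_space UNIV) (\<lambda>x. x)"

text \<open>
  Words over the alphabet are lists and bits are Booleans.  Codewords have positive length
  (they range over the nonempty bit lists).  The maps \<open>\<Phi>\<close> and \<open>\<Psi>\<close> are only constrained on
  keys and plaintexts of length \<open>n\<close> and on nonempty ciphertexts; their other values are irrelevant.
\<close>

definition vl_scheme ::
  "nat \<Rightarrow> ('a list \<Rightarrow> 'a list \<Rightarrow> bool list) \<Rightarrow> ('a list \<Rightarrow> bool list \<Rightarrow> 'a list) \<Rightarrow> bool" where
  "vl_scheme n \<Phi> \<Psi> \<longleftrightarrow>
     (\<forall>k x. length k = n \<longrightarrow> length x = n \<longrightarrow> \<Phi> k x \<noteq> []) \<and>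
     (\<forall>k c. length k = n \<longrightarrow> c \<noteq> [] \<longrightarrow> length (\<Psi> k c) = n) \<and>
     (\<forall>k x. length k = n \<longrightarrow> length x = n \<longrightarrow> \<Psi> k (\<Phi> k x) = x)"

text \<open>The joint law of the pair (source block, key block).\<close>

definition source_key_pmf :: "nat \<Rightarrow> 'a pmf \<Rightarrow> 'a pmf \<Rightarrow> ('a list \<times> 'a list) pmf" where
  "source_key_pmf n pX pK = pair_pmf (replicate_pmf n pX) (replicate_pmf n pK)"

definition avg_length ::
  "nat \<Rightarrow> 'a pmf \<Rightarrow> 'a pmf \<Rightarrow> ('a list \<Rightarrow> 'a list \<Rightarrow> bool list) \<Rightarrow> real" where
  "avg_length n pX pK \<Phi> =
     measure_pmf.expectation (source_key_pmf n pX pK) (\<lambda>(x, k). real (length (\<Phi> k x)))"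

definition leakage ::
  "nat \<Rightarrow> 'a pmf \<Rightarrow> 'a pmf \<Rightarrow> ('a list \<Rightarrow> 'a list \<Rightarrow> bool list) \<Rightarrow> real" where
  "leakage n pX pK \<Phi> =
     prob_space.mutual_information (measure_pmf (source_key_pmf n pX pK)) 2
       (count_space UNIV) (count_space UNIV) (\<lambda>(x, k). \<Phi> k x) (\<lambda>(x, k). x)"

definition admissible :: "real \<Rightarrow> 'a pmf \<Rightarrow> 'a pmf \<Rightarrow> real \<Rightarrow> bool" where
  "admissible \<delta> pX pK R \<longleftrightarrow>
     (\<exists>\<Phi> \<Psi>. (\<forall>n\<ge>1. vl_scheme n (\<Phi> n) (\<Psi> n)) \<and>
       (\<forall>\<gamma>>0. \<exists>n0\<ge>1. \<forall>n\<ge>n0.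
          1 / real n * avg_length n pX pK (\<Phi> n) \<le> R + \<gamma> \<and>
          leakage n pX pK (\<Phi> n) \<le> \<delta>))"

definition R_v_inf_delta :: "real \<Rightarrow> 'a pmf \<Rightarrow> 'a pmf \<Rightarrow> ereal" where
  "R_v_inf_delta \<delta> pX pK = Inf (ereal ` {R. admissible \<delta> pX pK R})"

definition R_v_inf :: "real \<Rightarrow> 'a pmf \<Rightarrow> 'a pmf \<Rightarrow> ereal" where
  "R_v_inf \<delta>0 pX pK = (SUP \<delta>\<in>{0<..\<delta>0}. R_v_inf_delta \<delta> pX pK)"

definition R_ast :: "'a::finite pmf \<Rightarrow> 'a pmf \<Rightarrow> ereal" where
  "R_ast pX pK =
     (if shannon_entropy pX < shannon_entropy pK then ereal (shannon_entropy pX) else \<infinity>)"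

definition R_star :: "'a::finite pmf \<Rightarrow> 'a pmf \<Rightarrow> ereal" where
  "R_star pX pK =
     (if shannon_entropy pX \<le> shannon_entropy pK then ereal (shannon_entropy pX) else \<infinity>)"

end

theory Submission
  imports Defs
begin

text \<open>
  Converse: for a fixed key the code is one-to-one, so for \<open>r < 1 / 2\<close> the sum of \<open>r\<close> to the
  codeword lengths is at most \<open>1 / (1 - 2 * r)\<close>; Gibbs' inequality turns this into a lower bound
  on the average length, and \<open>r\<close> is sent to \<open>1 / 2\<close>.

  Achievability at a rate \<open>R\<close> strictly between the two entropies: all but an exponentially small
  part of the source lies in a set of \<open>2 powr (n * R)\<close> words, and all but an exponentially small
  part of the key consists of words of probability far below \<open>2 powr (- n * R)\<close>.  Distributing
  these keys greedily over about \<open>2 powr (n * R)\<close> bins gives an almost uniform bin number, used as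
  a one-time pad for the index of the source word.  In the exceptional cases the source word is
  sent in the clear after a flag bit; this costs \<open>O(n)\<close> bits of length and leakage, times an
  exponentially small probability.
\<close>

section \<open>Finite expectations, block laws, entropy and mutual information\<close>

lemma log_le_minus_one:
  fixes x :: real
  assumes "x > 0"
  shows "log 2 x \<le> (x - 1) / ln 2"
  using ln_le_minus_one[OF assms] by (simp add: log_def divide_right_mono)

lemma expectation_pair_pmf_iterated:
  fixes f :: "'a \<times> 'b \<Rightarrow> real"
  assumes "finite (set_pmf p)" "finite (set_pmf q)"
  shows "measure_pmf.expectation (pair_pmf p q) f =
    measure_pmf.expectation p (\<lambda>x. measure_pmf.expectation q (\<lambda>y. f (x, y)))"
proof -
  have "measure_pmf.expectation (pair_pmf p q) f =
    (\<Sum>a\<in>set_pmf p \<times> set_pmf q. f a * pmf (pair_pmf p q) a)"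
    by (rule integral_measure_pmf_real) (use assms in auto)
  also have "\<dots> = (\<Sum>x\<in>set_pmf p. \<Sum>y\<in>set_pmf q. f (x, y) * (pmf p x * pmf q y))"
    by (subst sum.cartesian_product) (auto simp: pmf_pair case_prod_unfold intro!: sum.cong)
  also have "\<dots> = (\<Sum>x\<in>set_pmf p. (\<Sum>y\<in>set_pmf q. f (x, y) * pmf q y) * pmf p x)"
    by (simp add: sum_distrib_right sum_distrib_left mult_ac)
  also have "\<dots> = (\<Sum>x\<in>set_pmf p. measure_pmf.expectation q (\<lambda>y. f (x, y)) * pmf p x)"
    by (simp add: integral_measure_pmf_real[OF assms(2)])
  also have "\<dots> = measure_pmf.expectation p (\<lambda>x. measure_pmf.expectation q (\<lambda>y. f (x, y)))"
    by (rule integral_measure_pmf_real[symmetric]) (use assms in auto)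
  finally show ?thesis .
qed

lemma finite_set_replicate_pmf:
  fixes p :: "'a::finite pmf"
  shows "finite (set_pmf (replicate_pmf n p))"
proof (rule finite_subset)
  show "set_pmf (replicate_pmf n p) \<subseteq> {xs. set xs \<subseteq> UNIV \<and> length xs = n}"
    by (auto simp: set_replicate_pmf)
qed (rule finite_lists_length_eq, simp)

lemma replicate_pmf_Suc_pair:
  "replicate_pmf (Suc n) p = map_pmf (\<lambda>(x, xs). x # xs) (pair_pmf p (replicate_pmf n p))"
  by (simp add: map_pmf_def pair_pmf_def bind_assoc_pmf bind_return_pmf)

lemma pmf_replicate_pmf_Cons:
  "pmf (replicate_pmf (Suc n) p) (x # xs) = pmf p x * pmf (replicate_pmf n p) xs"
proof -
  have "inj (\<lambda>(x::'a, xs). x # xs)"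
    by (auto simp: inj_def)
  from pmf_map_inj'[OF this, of "pair_pmf p (replicate_pmf n p)" "(x, xs)"]
  show ?thesis
    by (simp add: replicate_pmf_Suc_pair pmf_pair del: replicate_pmf.simps)
qed

text \<open>The letters of a block are independent; this is how the exponential moment of a letter
  sum factorises in the tail bound.\<close>

lemma expectation_replicate_pmf_prod_list:
  fixes p :: "'a::finite pmf" and g :: "'a \<Rightarrow> real"
  shows "measure_pmf.expectation (replicate_pmf n p) (\<lambda>xs. prod_list (map g xs)) =
    measure_pmf.expectation p g ^ n"
proof (induction n)
  case (Suc n)
  then show ?case
    by (simp add: replicate_pmf_Suc_pair case_prod_unfold expectation_pair_pmf_iterated
        finite_set_replicate_pmf del: replicate_pmf.simps(2))
qed simp

lemma expectation_replicate_pmf_sum_list: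
  fixes p :: "'a::finite pmf" and g :: "'a \<Rightarrow> real"
  shows "measure_pmf.expectation (replicate_pmf n p) (\<lambda>xs. sum_list (map g xs)) =
    real n * measure_pmf.expectation p g"
proof (induction n)
  case (Suc n)
  have "integrable (measure_pmf (replicate_pmf n p)) (f :: 'a list \<Rightarrow> real)"
       "integrable (measure_pmf p) (h :: 'a \<Rightarrow> real)" for f h
    by (auto intro!: integrable_measure_pmf_finite finite_set_replicate_pmf)
  with Suc show ?case
    by (simp add: replicate_pmf_Suc_pair case_prod_unfold expectation_pair_pmf_iterated
        finite_set_replicate_pmf algebra_simps del: replicate_pmf.simps(2))
qed simp

text \<open>Makes block probabilities accessible to tail bounds for letter sums. On the support
  every factor is positive, so the logarithm of the product splits.\<close>

lemma log_pmf_replicate_pmf: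
  assumes "xs \<in> set_pmf (replicate_pmf n p)"
  shows "log 2 (pmf (replicate_pmf n p) xs) = (\<Sum>x\<leftarrow>xs. log 2 (pmf p x))"
  using assms
proof (induction n arbitrary: xs)
  case (Suc n)
  then obtain y ys where xs: "xs = y # ys" "y \<in> set_pmf p" "ys \<in> set_pmf (replicate_pmf n p)"
    by (auto simp del: set_replicate_pmf)
  then have "pmf p y > 0" "pmf (replicate_pmf n p) ys > 0"
    by (simp_all add: pmf_positive)
  with xs Suc.IH[of ys] show ?case
    by (simp add: pmf_replicate_pmf_Cons log_mult del: replicate_pmf.simps)
qed (simp add: set_replicate_pmf)

lemma shannon_entropy_eq_expectation:
  fixes p :: "'a::finite pmf"
  shows "shannon_entropy p = measure_pmf.expectation p (\<lambda>x. - log 2 (pmf p x))"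
proof -
  interpret information_space "measure_pmf p" 2
    by unfold_locales simp
  have "simple_distributed (measure_pmf p) (\<lambda>x. x) (pmf p)"
    by (rule measure_pmf.simple_distributedI) (auto simp: simple_function_def pmf.rep_eq vimage_def)
  from entropy_simple_distributed[OF this]
  have "shannon_entropy p = - (\<Sum>x\<in>UNIV. pmf p x * log 2 (pmf p x))"
    by (simp add: shannon_entropy_def)
  also have "\<dots> = measure_pmf.expectation p (\<lambda>x. - log 2 (pmf p x))"
    by (simp add: integral_measure_pmf_real[of UNIV] mult.commute sum_negf)
  finally show ?thesis .
qed

text \<open>Mutual information is the divergence of the joint law from the product of the marginals.
  On countable types the product of the counting measures is again a counting measure, so both laws
  have their mass functions as densities and the divergence becomes an expectation of a log
  ratio.\<close>

lemma mutual_information_pmf_eq: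
  fixes p :: "'w pmf" and U :: "'w \<Rightarrow> 'b::countable" and V :: "'w \<Rightarrow> 'c::countable"
  assumes fin: "finite (set_pmf p)"
  shows "prob_space.mutual_information (measure_pmf p) 2 (count_space UNIV) (count_space UNIV) U V =
    measure_pmf.expectation p (\<lambda>w. log 2 (pmf (map_pmf (\<lambda>w. (U w, V w)) p) (U w, V w) /
      (pmf (map_pmf U p) (U w) * pmf (map_pmf V p) (V w))))"
proof -
  interpret information_space "measure_pmf p" 2
    by unfold_locales simp
  define J where "J = map_pmf (\<lambda>w. (U w, V w)) p"
  define Q where "Q = pair_pmf (map_pmf U p) (map_pmf V p)"
  have pair: "count_space UNIV \<Otimes>\<^sub>M count_space UNIV = (count_space UNIV :: ('b \<times> 'c) measure)"
    by (simp add: pair_measure_countable)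
  have distr: "distr (measure_pmf p) (count_space UNIV) f = measure_pmf (map_pmf f p)" for f :: "'w \<Rightarrow> 'd"
    by (simp add: map_pmf_rep_eq)
  have Q: "measure_pmf (map_pmf U p) \<Otimes>\<^sub>M measure_pmf (map_pmf V p) = measure_pmf Q"
    (is "?L = _")
  proof (rule measure_eqI_countable[of _ UNIV])
    have "sets ?L = sets (count_space UNIV \<Otimes>\<^sub>M count_space UNIV)"
      by (intro sets_pair_measure_cong) auto
    then show "sets ?L = Pow UNIV"
      unfolding pair by simp
    show "emeasure ?L {a} = emeasure (measure_pmf Q) {a}" for a
    proof -
      have "emeasure ?L ({fst a} \<times> {snd a}) =
        emeasure (measure_pmf (map_pmf U p)) {fst a} * emeasure (measure_pmf (map_pmf V p)) {snd a}"
        by (rule measure_pmf.emeasure_pair_measure_Times) auto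
      then show ?thesis
        by (cases a) (simp add: Q_def emeasure_pmf_single pmf_pair ennreal_mult)
    qed
  qed auto
  have "prob_space.mutual_information (measure_pmf p) 2 (count_space UNIV) (count_space UNIV) U V =
    KL_divergence 2 (measure_pmf Q) (measure_pmf J)"
    by (simp add: prob_space.mutual_information_def[OF measure_pmf.prob_space_axioms] distr pair Q J_def map_pmf_rep_eq[symmetric])
  also have "\<dots> = (\<integral>x. pmf J x * log 2 (pmf J x / pmf Q x) \<partial>count_space UNIV)"
    unfolding measure_pmf_eq_density
  proof (rule sigma_finite_measure.KL_density_density)
    show "AE x in count_space UNIV. pmf Q x = 0 \<longrightarrow> pmf J x = 0"
      by (auto simp: pmf_eq_0_set_pmf J_def Q_def)
  qed (auto simp: sigma_finite_measure_count_space)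
  also have "\<dots> = measure_pmf.expectation J (\<lambda>x. log 2 (pmf J x / pmf Q x))"
    by (subst measure_pmf_eq_density, subst integral_density) auto
  also have "\<dots> = measure_pmf.expectation p (\<lambda>w. log 2 (pmf J (U w, V w) / pmf Q (U w, V w)))"
    by (simp add: J_def)
  finally show ?thesis
    by (simp add: J_def Q_def pmf_pair)
qed

section \<open>Exponential tail bounds for letter sums\<close>

text \<open>The moment generating function has value 1 at 0 and its derivative there is the mean of
  \<open>f\<close>, which is negative; just to the right of 0 it therefore drops below 1.\<close>

lemma ex_expectation_exp_less_1:
  fixes p :: "'a::finite pmf" and f :: "'a \<Rightarrow> real"
  assumes "measure_pmf.expectation p f < 0"
  obtains s where "s > 0" "measure_pmf.expectation p (\<lambda>x. exp (s * f x)) < 1"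
proof -
  define G where "G s = (\<Sum>x\<in>UNIV. exp (s * f x) * pmf p x)" for s
  have G: "measure_pmf.expectation p (\<lambda>x. exp (s * f x)) = G s" for s
    unfolding G_def by (rule integral_measure_pmf_real) auto
  have "(G has_real_derivative (\<Sum>x\<in>UNIV. f x * pmf p x)) (at 0)"
    unfolding G_def by (auto intro!: derivative_eq_intros)
  moreover have "(\<Sum>x\<in>UNIV. f x * pmf p x) < 0"
    using assms by (simp add: integral_measure_pmf_real[of UNIV])
  ultimately obtain d where "d > 0" "\<And>h. 0 < h \<Longrightarrow> h < d \<Longrightarrow> G (0 + h) < G 0"
    using has_real_derivative_neg_dec_right[of G _ 0 UNIV] by auto
  from this(2)[of "d / 2"] \<open>d > 0\<close> have "G (d / 2) < G 0"
    by simp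
  also have "G 0 = 1"
    using G[of 0] by simp
  finally show ?thesis
    using \<open>d > 0\<close> G[of "d / 2"] by (intro that[of "d / 2"]) simp_all
qed

text \<open>On the event the exponential of \<open>s\<close> times the sum is at least 1, so its
  expectation bounds the probability. By independence that expectation is the \<open>n\<close>-th
  power of the one-letter moment, which is the \<open>r\<close> returned and does not depend on
  \<open>n\<close>.\<close>

lemma chernoff_replicate_pmf:
  fixes p :: "'a::finite pmf" and f :: "'a \<Rightarrow> real"
  assumes "measure_pmf.expectation p f < 0"
  obtains r where "0 \<le> r" "r < 1"
    "\<And>n. measure_pmf.prob (replicate_pmf n p) {xs. sum_list (map f xs) \<ge> 0} \<le> r ^ n"
proof -
  from ex_expectation_exp_less_1[OF assms] obtain s where s: "s > 0"
    "measure_pmf.expectation p (\<lambda>x. exp (s * f x)) < 1" .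
  show ?thesis
  proof (rule that[OF _ s(2)])
    show "0 \<le> measure_pmf.expectation p (\<lambda>x. exp (s * f x))"
      by (rule integral_nonneg_AE) auto
    fix n
    have "measure_pmf.prob (replicate_pmf n p) {xs. sum_list (map f xs) \<ge> 0} =
      measure_pmf.expectation (replicate_pmf n p) (indicator {xs. sum_list (map f xs) \<ge> 0})"
      by simp
    also have "\<dots> \<le> measure_pmf.expectation (replicate_pmf n p) (\<lambda>xs. exp (s * sum_list (map f xs)))"
      using s(1) by (intro integral_mono)
        (auto simp: indicator_def intro!: integrable_measure_pmf_finite finite_set_replicate_pmf)
    also have "(\<lambda>xs. exp (s * sum_list (map f xs))) = (\<lambda>xs. prod_list (map (\<lambda>x. exp (s * f x)) xs))"
    proof
      show "exp (s * sum_list (map f xs)) = prod_list (map (\<lambda>x. exp (s * f x)) xs)" for xs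
        by (induction xs) (simp_all add: distrib_left exp_add)
    qed
    also have "measure_pmf.expectation (replicate_pmf n p) \<dots> =
      measure_pmf.expectation p (\<lambda>x. exp (s * f x)) ^ n"
      by (rule expectation_replicate_pmf_prod_list)
    finally show "measure_pmf.prob (replicate_pmf n p) {xs. sum_list (map f xs) \<ge> 0} \<le>
      measure_pmf.expectation p (\<lambda>x. exp (s * f x)) ^ n" .
  qed
qed

section \<open>Balanced binning of keys and bit-string labels\<close>

text \<open>Items are placed one at a time, each into a bin whose load is at most the average
  \<open>1 / M\<close>; a bin that receives an item thus ends at most one item weight above the
  average. An upper bound on the loads is all that the leakage estimate asks for.\<close>

lemma balanced_binning:
  fixes q :: "'a \<Rightarrow> real"
  assumes "finite A" "M > 0" "\<And>a. a \<in> A \<Longrightarrow> 0 \<le> q a" "\<And>a. a \<in> A \<Longrightarrow> q a \<le> \<tau>"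
    and "0 \<le> \<tau>" "sum q A \<le> 1"
  obtains f where "\<And>a. f a < M" "\<And>j. j < M \<Longrightarrow> sum q {a \<in> A. f a = j} \<le> 1 / real M + \<tau>"
proof -
  have "\<exists>f. (\<forall>a. f a < M) \<and> (\<forall>j<M. sum q {a \<in> A. f a = j} \<le> 1 / real M + \<tau>)"
    using assms(1,3,4,6)
  proof (induction A rule: finite_induct)
    case empty
    show ?case
      using assms(2,5) by (intro exI[of _ "\<lambda>_. 0"]) auto
  next
    case (insert a A)
    then obtain f where f: "\<And>a. f a < M" "\<And>j. j < M \<Longrightarrow> sum q {a \<in> A. f a = j} \<le> 1 / real M + \<tau>"
      by force
    \<comment> \<open>If all \<open>M\<close> loads exceeded \<open>1 / M\<close>, the total weight
      would exceed 1.\<close>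
    have "\<exists>i<M. sum q {a \<in> A. f a = i} \<le> 1 / real M"
    proof (rule ccontr)
      assume "\<not> ?thesis"
      then have "(\<Sum>i<M. 1 / real M) < (\<Sum>i<M. sum q {a \<in> A. f a = i})"
        using assms(2) by (intro sum_strict_mono) auto
      also have "\<dots> = sum q A"
        by (rule sum.group) (use insert f in auto)
      also have "\<dots> \<le> 1"
        using insert.prems(1)[of a] insert.prems(3) insert.hyps by simp
      finally show False
        using assms(2) by simp
    qed
    then obtain i where i: "i < M" "sum q {a \<in> A. f a = i} \<le> 1 / real M"
      by blast
    have eq: "{b \<in> insert a A. (f(a := i)) b = j} =
      (if j = i then insert a {b \<in> A. f b = j} else {b \<in> A. f b = j})" for j
      using insert.hyps by auto
    have "sum q {b \<in> insert a A. (f(a := i)) b = j} \<le> 1 / real M + \<tau>" if "j < M" for j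
      unfolding eq using f(2)[OF that] i insert.prems(2)[of a] insert.hyps by auto
    then show ?case
      using f(1) i(1) by (intro exI[of _ "f(a := i)"]) auto
  qed
  then show ?thesis
    using that by blast
qed

lemma card_bool_lists: "card {bs :: bool list. length bs = m} = 2 ^ m"
  using card_lists_length_eq[of "UNIV :: bool set" m] by simp

lemma finite_bool_lists: "finite {bs :: bool list. length bs = m}"
  using finite_lists_length_eq[of "UNIV :: bool set" m] by simp

lemma ex_inj_bool_lists:
  assumes "finite A" "card A \<le> 2 ^ m"
  obtains f :: "'a \<Rightarrow> bool list" where "inj_on f A" "\<And>a. a \<in> A \<Longrightarrow> length (f a) = m"
proof -
  have "\<exists>f. f ` A \<subseteq> {bs :: bool list. length bs = m} \<and> inj_on f A"
    by (rule card_le_inj) (use assms in \<open>auto simp: card_bool_lists finite_bool_lists\<close>)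
  then show ?thesis
    using that by (auto simp: image_subset_iff)
qed

section \<open>Converse: lower bound on the average length\<close>

lemma sum_power_length_le:
  fixes r :: real
  assumes "finite A" "0 < r" "r < 1 / 2"
  shows "(\<Sum>c\<in>A. r ^ length (c :: bool list)) \<le> 1 / (1 - 2 * r)"
proof -
  define N where "N = Suc (Max (insert 0 (length ` A)))"
  have "(\<Sum>c\<in>A. r ^ length c) = (\<Sum>l<N. \<Sum>c\<in>{c \<in> A. length c = l}. r ^ length c)"
    by (rule sum.group[symmetric])
      (use assms(1) in \<open>auto simp: N_def less_Suc_eq_le intro!: Max_ge\<close>)
  also have "\<dots> = (\<Sum>l<N. real (card {c \<in> A. length c = l}) * r ^ l)"
    by simp
  also have "\<dots> \<le> (\<Sum>l<N. 2 ^ l * r ^ l)"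
  proof (intro sum_mono mult_right_mono)
    fix l
    have "card {c \<in> A. length c = l} \<le> card {c :: bool list. length c = l}"
      by (rule card_mono) (auto simp: finite_bool_lists)
    then show "real (card {c \<in> A. length c = l}) \<le> 2 ^ l"
      by (metis card_bool_lists of_nat_le_iff of_nat_numeral of_nat_power)
  qed (use assms in auto)
  also have "\<dots> = (\<Sum>l<N. (2 * r) ^ l)"
    by (simp add: power_mult_distrib)
  also have "\<dots> = (1 - (2 * r) ^ N) / (1 - 2 * r)"
    using assms by (subst sum_gp_strict) auto
  also have "\<dots> \<le> 1 / (1 - 2 * r)"
    using assms by (intro divide_right_mono) auto
  finally show ?thesis .
qed

text \<open>The bound of \<open>log 2 t\<close> by \<open>(t - 1) / ln 2\<close> is applied at
  \<open>t = w x / pmf p x / W\<close> and averaged. The total \<open>W\<close> need not be 1: the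
  converse uses \<open>1 / (1 - 2 * r)\<close>, the leakage bound uses 1.\<close>

lemma gibbs_inequality:
  fixes p :: "'a pmf" and w :: "'a \<Rightarrow> real"
  assumes "finite (set_pmf p)" "\<And>x. x \<in> set_pmf p \<Longrightarrow> w x > 0" "sum w (set_pmf p) \<le> W"
  shows "measure_pmf.expectation p (\<lambda>x. log 2 (w x / pmf p x)) \<le> log 2 W"
proof -
  have pos: "pmf p x > 0" if "x \<in> set_pmf p" for x
    using that by (simp add: pmf_positive)
  have sum1: "(\<Sum>x\<in>set_pmf p. pmf p x) = 1"
    using assms(1) by (simp add: sum_pmf_eq_1)
  have "sum w (set_pmf p) > 0"
    using assms by (intro sum_pos) (auto simp: set_pmf_not_empty)
  with assms(3) have W: "W > 0" by linarith
  have "measure_pmf.expectation p (\<lambda>x. log 2 (w x / pmf p x)) =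
    (\<Sum>x\<in>set_pmf p. log 2 (w x / pmf p x) * pmf p x)"
    by (rule integral_measure_pmf_real) (use assms in auto)
  also have "\<dots> \<le> (\<Sum>x\<in>set_pmf p. log 2 W * pmf p x + (w x / W - pmf p x) / ln 2)"
  proof (rule sum_mono)
    fix x assume x: "x \<in> set_pmf p"
    have "log 2 (w x / pmf p x) = log 2 W + log 2 (w x / pmf p x / W)"
      using pos[OF x] assms(2)[OF x] W by (simp add: log_divide log_mult)
    also have "\<dots> \<le> log 2 W + (w x / pmf p x / W - 1) / ln 2"
      using pos[OF x] assms(2)[OF x] W by (intro add_left_mono log_le_minus_one) auto
    finally have "log 2 (w x / pmf p x) * pmf p x \<le>
      (log 2 W + (w x / pmf p x / W - 1) / ln 2) * pmf p x"
      using pos[OF x] by (intro mult_right_mono) auto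
    also have "\<dots> = log 2 W * pmf p x + (w x / W - pmf p x) / ln 2"
      using pos[OF x] W by (simp add: field_simps)
    finally show "log 2 (w x / pmf p x) * pmf p x \<le> log 2 W * pmf p x + (w x / W - pmf p x) / ln 2" .
  qed
  also have "\<dots> = log 2 W + (sum w (set_pmf p) / W - 1) / ln 2"
    by (simp add: sum.distrib sum1 sum_subtractf flip: sum_distrib_left sum_divide_distrib)
  also have "\<dots> \<le> log 2 W"
    using assms(3) W by (simp add: divide_nonpos_pos)
  finally show ?thesis .
qed

lemma expectation_log_pmf_replicate_pmf:
  fixes p :: "'a::finite pmf"
  shows "measure_pmf.expectation (replicate_pmf n p) (\<lambda>x. log 2 (pmf (replicate_pmf n p) x)) =
    - (real n * shannon_entropy p)"
proof -
  have "measure_pmf.expectation (replicate_pmf n p) (\<lambda>x. log 2 (pmf (replicate_pmf n p) x)) =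
    measure_pmf.expectation (replicate_pmf n p) (\<lambda>x. \<Sum>y\<leftarrow>x. log 2 (pmf p y))"
    by (rule integral_cong_AE) (simp_all add: AE_measure_pmf_iff log_pmf_replicate_pmf)
  also have "\<dots> = - (real n * shannon_entropy p)"
    by (simp add: expectation_replicate_pmf_sum_list shannon_entropy_eq_expectation)
  finally show ?thesis .
qed

text \<open>For each fixed key, decodability makes the encoder injective, so the weights
  \<open>r ^ length (\<Phi> k x)\<close> have total at most \<open>1 / (1 - 2 * r)\<close> and
  Gibbs' inequality applies to the source law. Averaging over the key finishes the bound.\<close>

lemma avg_length_lower_bound:
  fixes pX pK :: "'a::finite pmf"
  assumes scheme: "vl_scheme n \<Phi> \<Psi>" and r: "0 < r" "r < 1 / 2"
  shows "real n * shannon_entropy pX \<le>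
    avg_length n pX pK \<Phi> * log 2 (1 / r) + log 2 (1 / (1 - 2 * r))"
proof -
  define P where "P = replicate_pmf n pX"
  define Q where "Q = replicate_pmf n pK"
  have fin: "finite (set_pmf P)" "finite (set_pmf Q)"
    by (simp_all add: P_def Q_def finite_set_replicate_pmf)
  have intgP: "integrable (measure_pmf P) (f :: 'a list \<Rightarrow> real)" for f
    by (rule integrable_measure_pmf_finite) (rule fin)
  have intgQ: "integrable (measure_pmf Q) (f :: 'a list \<Rightarrow> real)" for f
    by (rule integrable_measure_pmf_finite) (rule fin)
  define L where "L = log 2 (1 / r)"
  define W where "W = log 2 (1 / (1 - 2 * r))"
  have per_key: "real n * shannon_entropy pX \<le>
    measure_pmf.expectation P (\<lambda>x. real (length (\<Phi> k x))) * L + W" if k: "k \<in> set_pmf Q" for k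
  proof -
    have len: "length k = n" "\<And>x. x \<in> set_pmf P \<Longrightarrow> length x = n"
      using k by (auto simp: P_def Q_def set_replicate_pmf)
    have inj: "inj_on (\<Phi> k) (set_pmf P)"
      using scheme len unfolding vl_scheme_def inj_on_def by metis
    have "measure_pmf.expectation P (\<lambda>x. log 2 (r ^ length (\<Phi> k x) / pmf P x)) \<le> W"
      unfolding W_def
    proof (rule gibbs_inequality[OF fin(1)])
      have "(\<Sum>x\<in>set_pmf P. r ^ length (\<Phi> k x)) = (\<Sum>c\<in>\<Phi> k ` set_pmf P. r ^ length c)"
        by (simp add: sum.reindex[OF inj])
      also have "\<dots> \<le> 1 / (1 - 2 * r)"
        using fin r by (intro sum_power_length_le) auto
      finally show "(\<Sum>x\<in>set_pmf P. r ^ length (\<Phi> k x)) \<le> 1 / (1 - 2 * r)" .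
    qed (use r in auto)
    also have "measure_pmf.expectation P (\<lambda>x. log 2 (r ^ length (\<Phi> k x) / pmf P x)) =
      measure_pmf.expectation P (\<lambda>x. real (length (\<Phi> k x)) * (- L) - log 2 (pmf P x))"
      by (rule integral_cong_AE)
        (use r in \<open>auto simp: AE_measure_pmf_iff log_divide log_nat_power pmf_eq_0_set_pmf L_def\<close>)
    also have "\<dots> = real n * shannon_entropy pX -
        measure_pmf.expectation P (\<lambda>x. real (length (\<Phi> k x))) * L"
      by (subst Bochner_Integration.integral_diff[OF intgP intgP])
        (simp add: P_def expectation_log_pmf_replicate_pmf)
    finally show ?thesis by simp
  qed
  have "real n * shannon_entropy pX = measure_pmf.expectation Q (\<lambda>_. real n * shannon_entropy pX)"
    by simp
  also have "\<dots> \<le> measure_pmf.expectation Q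
      (\<lambda>k. measure_pmf.expectation P (\<lambda>x. real (length (\<Phi> k x))) * L + W)"
    by (rule integral_mono_AE[OF intgQ intgQ]) (simp add: AE_measure_pmf_iff per_key)
  also have "\<dots> = measure_pmf.expectation Q
      (\<lambda>k. measure_pmf.expectation P (\<lambda>x. real (length (\<Phi> k x)))) * L + W"
    by (subst Bochner_Integration.integral_add[OF intgQ intgQ]) simp
  \<comment> \<open>The source comes first in \<open>source_key_pmf\<close>, so the pair is swapped
    to have the key as the outer integration.\<close>
  also have "measure_pmf.expectation Q
      (\<lambda>k. measure_pmf.expectation P (\<lambda>x. real (length (\<Phi> k x)))) = avg_length n pX pK \<Phi>"
    unfolding avg_length_def source_key_pmf_def P_def[symmetric] Q_def[symmetric]
    by (subst pair_commute_pmf) (simp add: expectation_pair_pmf_iterated[OF fin(2,1)] case_prod_unfold)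
  finally show ?thesis
    by (simp add: L_def W_def)
qed

text \<open>The additive term of the length bound is constant in \<open>n\<close> and disappears
  after division by \<open>n\<close>; the remaining factor \<open>log 2 (1 / r)\<close> tends to 1
  as \<open>r\<close> tends to \<open>1 / 2\<close>.\<close>

lemma shannon_entropy_le_admissible:
  fixes pX pK :: "'a::finite pmf"
  assumes "admissible \<delta> pX pK R"
  shows "shannon_entropy pX \<le> R"
proof -
  from assms obtain \<Phi> \<Psi> where adm: "\<forall>n\<ge>1. vl_scheme n (\<Phi> n) (\<Psi> n)"
    "\<forall>\<gamma>>0. \<exists>n0\<ge>1. \<forall>n\<ge>n0. 1 / real n * avg_length n pX pK (\<Phi> n) \<le> R + \<gamma> \<and>
      leakage n pX pK (\<Phi> n) \<le> \<delta>"
    unfolding admissible_def by (elim exE conjE)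
  note scheme = adm(1)[rule_format]
  have bound: "shannon_entropy pX \<le> R * log 2 (1 / r)" if r: "0 < r" "r < 1 / 2" for r
  proof (rule field_le_epsilon)
    fix e :: real assume "e > 0"
    define L where "L = log 2 (1 / r)"
    define W where "W = log 2 (1 / (1 - 2 * r))"
    \<comment> \<open>The slack \<open>e / L\<close> chosen next becomes \<open>e\<close> once the
      length bound is multiplied by \<open>L\<close>.\<close>
    have "L > 0"
      using r by (auto simp: L_def)
    with \<open>e > 0\<close> adm(2)[rule_format, of "e / L"] obtain n0 where
      n0: "n0 \<ge> 1" "\<And>n. n \<ge> n0 \<Longrightarrow> 1 / real n * avg_length n pX pK (\<Phi> n) \<le> R + e / L"
      by auto
    have le: "real n * (shannon_entropy pX - (R * L + e)) \<le> W" if "n \<ge> n0" for n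
    proof -
      have "avg_length n pX pK (\<Phi> n) \<le> real n * (R + e / L)"
        using n0(2)[OF that] n0(1) that by (simp add: field_simps)
      then have "avg_length n pX pK (\<Phi> n) * L \<le> real n * (R + e / L) * L"
        using \<open>L > 0\<close> by (intro mult_right_mono) auto
      also have "\<dots> = real n * (R * L + e)"
        using \<open>L > 0\<close> by (simp add: field_simps)
      finally show ?thesis
        using avg_length_lower_bound[OF scheme r, of n pX pK] n0(1) that
        by (simp add: L_def W_def algebra_simps)
    qed
    \<comment> \<open>A positive gap, multiplied by a large enough \<open>n\<close>, would exceed
      the constant \<open>W\<close>.\<close>
    have "\<not> shannon_entropy pX - (R * L + e) > 0"
    proof
      assume pos: "shannon_entropy pX - (R * L + e) > 0"
      obtain n where "W < real n * (shannon_entropy pX - (R * L + e))"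
        using reals_Archimedean3[OF pos] by blast
      also have "\<dots> \<le> real (max n n0) * (shannon_entropy pX - (R * L + e))"
        using pos by (intro mult_right_mono) auto
      also have "\<dots> \<le> W"
        by (rule le) simp
      finally show False by simp
    qed
    then show "shannon_entropy pX \<le> R * log 2 (1 / r) + e"
      by (simp add: L_def)
  qed
  have "((\<lambda>r. R * log 2 (1 / r)) \<longlongrightarrow> R * log 2 (1 / (1 / 2))) (at_left (1 / 2))"
    by (intro tendsto_intros) auto
  moreover have "\<forall>\<^sub>F r in at_left (1 / 2). shannon_entropy pX \<le> R * log 2 (1 / r)"
    using eventually_at_left_real[of 0 "1 / 2"] by (auto elim!: eventually_mono intro: bound)
  ultimately have "shannon_entropy pX \<le> R * log 2 (1 / (1 / 2))"
    by (rule tendsto_lowerbound) simp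
  then show ?thesis by simp
qed

section \<open>The scheme for a fixed block length and its leakage\<close>

text \<open>The decoder inverts the encoder on its image. Elsewhere it returns a dummy block of
  length \<open>n\<close>, since \<open>vl_scheme\<close> demands output of that length on every
  nonempty ciphertext.\<close>

lemma ex_vl_scheme_of_inj:
  assumes "\<And>k x. length k = n \<Longrightarrow> length x = n \<Longrightarrow> \<Phi> k x \<noteq> []"
    and "\<And>k. length k = n \<Longrightarrow> inj_on (\<Phi> k) {x :: 'a list. length x = n}"
  shows "\<exists>\<Psi>. vl_scheme n \<Phi> \<Psi>"
proof
  define \<Psi> where "\<Psi> k c = (if c \<in> \<Phi> k ` {x. length x = n} then inv_into {x. length x = n} (\<Phi> k) c
    else replicate n undefined)" for k c
  show "vl_scheme n \<Phi> \<Psi>"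
    unfolding vl_scheme_def
  proof (intro conjI allI impI)
    show "length (\<Psi> k c) = n" for k c
      using inv_into_into[of c "\<Phi> k" "{x. length x = n}"] by (auto simp: \<Psi>_def)
    show "\<Psi> k (\<Phi> k x) = x" if "length k = n" "length x = n" for k x
      using that assms(2)[of k] by (auto simp: \<Psi>_def)
  qed (use assms(1) in auto)
qed

text \<open>The one-time pad, read in both directions: a known key bin reveals the index of the
  source word, and a known source word reveals the key bin.\<close>

lemma mod_add_left_cancel:
  fixes a b c M :: nat
  assumes "(a + b) mod M = (a + c) mod M" "b < M" "c < M"
  shows "b = c"
proof (rule ccontr)
  have *: False if "(a + b) mod M = (a + c) mod M" "b < M" "c < M" "c < b" for b c
  proof -
    have "M dvd (a + b) - (a + c)"
      using that mod_eq_dvd_iff_nat[of "a + c" "a + b" M] by simp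
    with that show False
      by (auto dest: dvd_imp_le)
  qed
  assume "b \<noteq> c"
  with *[of b c] *[of c b] assms show False
    by (auto simp: neq_iff)
qed

text \<open>By Gibbs' inequality the marginal of \<open>U\<close> may be replaced by any sub-distribution \<open>G\<close>;
  this avoids computing the law of the ciphertext.\<close>

lemma mutual_information_pmf_le:
  fixes p :: "'w pmf" and U :: "'w \<Rightarrow> 'b::countable" and V :: "'w \<Rightarrow> 'c::countable"
  assumes fin: "finite (set_pmf p)"
    and G: "\<And>w. w \<in> set_pmf p \<Longrightarrow> G (U w) > 0" "sum G (U ` set_pmf p) \<le> 1"
  shows "prob_space.mutual_information (measure_pmf p) 2 (count_space UNIV) (count_space UNIV) U V \<le>
    measure_pmf.expectation p (\<lambda>w. log 2 (pmf (map_pmf (\<lambda>w. (U w, V w)) p) (U w, V w) /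
      (G (U w) * pmf (map_pmf V p) (V w))))" (is "?I \<le> ?B")
proof -
  have intg: "integrable (measure_pmf p) (f :: _ \<Rightarrow> real)" for f
    by (rule integrable_measure_pmf_finite) (rule fin)
  have "?I = measure_pmf.expectation p (\<lambda>w. log 2 (pmf (map_pmf (\<lambda>w. (U w, V w)) p) (U w, V w) /
      (G (U w) * pmf (map_pmf V p) (V w))) + log 2 (G (U w) / pmf (map_pmf U p) (U w)))"
    unfolding mutual_information_pmf_eq[OF fin]
  proof (rule integral_cong_AE)
    show "AE w in measure_pmf p. log 2 (pmf (map_pmf (\<lambda>w. (U w, V w)) p) (U w, V w) /
        (pmf (map_pmf U p) (U w) * pmf (map_pmf V p) (V w))) =
      log 2 (pmf (map_pmf (\<lambda>w. (U w, V w)) p) (U w, V w) /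
        (G (U w) * pmf (map_pmf V p) (V w))) + log 2 (G (U w) / pmf (map_pmf U p) (U w))"
      unfolding AE_measure_pmf_iff
    proof
      fix w assume w: "w \<in> set_pmf p"
      then have "pmf (map_pmf (\<lambda>w. (U w, V w)) p) (U w, V w) > 0" "pmf (map_pmf U p) (U w) > 0"
        "pmf (map_pmf V p) (V w) > 0"
        by (auto intro!: pmf_positive)
      with G(1)[OF w] show "log 2 (pmf (map_pmf (\<lambda>w. (U w, V w)) p) (U w, V w) /
        (pmf (map_pmf U p) (U w) * pmf (map_pmf V p) (V w))) =
      log 2 (pmf (map_pmf (\<lambda>w. (U w, V w)) p) (U w, V w) /
        (G (U w) * pmf (map_pmf V p) (V w))) + log 2 (G (U w) / pmf (map_pmf U p) (U w))"
        by (simp add: log_divide_pos log_mult_pos)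
    qed
  qed auto
  also have "\<dots> = ?B + measure_pmf.expectation p (\<lambda>w. log 2 (G (U w) / pmf (map_pmf U p) (U w)))"
    by (rule Bochner_Integration.integral_add[OF intg intg])
  also have "measure_pmf.expectation p (\<lambda>w. log 2 (G (U w) / pmf (map_pmf U p) (U w))) =
      measure_pmf.expectation (map_pmf U p) (\<lambda>c. log 2 (G c / pmf (map_pmf U p) c))"
    by simp
  also have "\<dots> \<le> log 2 1"
    by (rule gibbs_inequality) (use fin G in auto)
  finally show ?thesis by simp
qed

text \<open>\<open>T\<close> holds the likely source words and \<open>S\<close> keys of small
  probability; \<beta> bounds the probability of leaving \<open>T\<close> or \<open>S\<close>. A
  flag bit is followed by the padded index in \<open>m\<close> bits or by the source word in
  \<open>n * b\<close> bits. The parameter \<eta> enters only the estimate and not the scheme, hence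
  the quantifier inside.\<close>

lemma ex_vl_scheme:
  fixes pX pK :: "'a::finite pmf" and T S :: "'a list set"
  assumes T: "T \<subseteq> {x. length x = n}" "card T \<le> 2 ^ m"
    and S: "S \<subseteq> {k. length k = n}" "\<forall>k\<in>S. pmf (replicate_pmf n pK) k \<le> \<tau>" "0 \<le> \<tau>"
    and b: "CARD('a) \<le> 2 ^ b"
  defines "\<beta> \<equiv> measure_pmf.prob (replicate_pmf n pX) (- T) + measure_pmf.prob (replicate_pmf n pK) (- S)"
  shows "\<exists>\<Phi> \<Psi>. vl_scheme n \<Phi> \<Psi> \<and>
    avg_length n pX pK \<Phi> \<le> real (m + 1) + \<beta> * real (n * b + 1) \<and>
    (\<forall>\<eta>\<in>{0<..<1}. leakage n pX pK \<Phi> \<le>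
      log 2 (1 + 2 ^ m * \<tau>) + log 2 (1 / (1 - \<eta>)) + \<beta> * (real (n * b) + log 2 (1 / \<eta>)))"
proof -
  define P where "P = replicate_pmf n pX"
  define Q where "Q = replicate_pmf n pK"
  define X where "X = {x :: 'a list. length x = n}"
  define M :: nat where "M = 2 ^ m"
  have "finite X"
    using finite_lists_length_eq[of "UNIV :: 'a set" n] by (simp add: X_def)
  have fin: "finite (set_pmf P)" "finite (set_pmf Q)"
    by (simp_all add: P_def Q_def finite_set_replicate_pmf)
  have supp: "set_pmf P \<subseteq> X" "set_pmf Q \<subseteq> X"
    by (auto simp: P_def Q_def X_def set_replicate_pmf)
  have TX: "T \<subseteq> X" "finite T" and SX: "S \<subseteq> X" "finite S"
    using T(1) S(1) \<open>finite X\<close> by (auto simp: X_def intro: finite_subset)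
  have "M > 0"
    by (simp add: M_def)
  obtain e where e: "inj_on e T" "\<And>x. x \<in> T \<Longrightarrow> e x < M"
    using card_le_inj[of T "{..<M}"] TX T(2) by (auto simp: M_def image_subset_iff)
  have sumS: "sum (pmf Q) S \<le> 1"
    using SX by (simp flip: measure_measure_pmf_finite)
  obtain f where f: "\<And>k. f k < M" "\<And>j. j < M \<Longrightarrow> sum (pmf Q) {k \<in> S. f k = j} \<le> 1 / real M + \<tau>"
    by (rule balanced_binning[OF SX(2) \<open>M > 0\<close>, of "pmf Q" \<tau>])
      (use S(2,3) sumS in \<open>auto simp: Q_def\<close>)
  obtain u :: "nat \<Rightarrow> bool list" where u: "inj_on u {..<M}" "\<And>j. j \<in> {..<M} \<Longrightarrow> length (u j) = m"
    by (rule ex_inj_bool_lists[of "{..<M}" m]) (auto simp: M_def)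
  have "card X = CARD('a) ^ n"
    using card_lists_length_eq[of "UNIV :: 'a set" n] by (simp add: X_def)
  also have "\<dots> \<le> (2 ^ b) ^ n"
    by (rule power_mono[OF b]) simp
  finally have "card X \<le> 2 ^ (n * b)"
    by (simp add: power_mult mult.commute)
  then obtain v :: "'a list \<Rightarrow> bool list" where v: "inj_on v X" "\<And>x. x \<in> X \<Longrightarrow> length (v x) = n * b"
    using ex_inj_bool_lists[OF \<open>finite X\<close>] by blast
  have vlen: "length (v x) = n * b" if "x \<in> set_pmf P" for x
    using v(2) supp(1) that by blast
  define \<Phi> where "\<Phi> k x = (if x \<in> T \<and> k \<in> S then False # u ((e x + f k) mod M) else True # v x)" for k x
  have "\<exists>\<Psi>. vl_scheme n \<Phi> \<Psi>"
  proof (rule ex_vl_scheme_of_inj)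
    show "inj_on (\<Phi> k) {x. length x = n}" for k
    proof (rule inj_onI)
      fix x y assume xy: "x \<in> {x. length x = n}" "y \<in> {x. length x = n}" and eq: "\<Phi> k x = \<Phi> k y"
      show "x = y"
      \<comment> \<open>Equal codewords share the flag bit and so fall under the same case for both
        words.\<close>
      proof (cases "x \<in> T \<and> k \<in> S")
        case True
        with eq have y: "y \<in> T"
          by (auto simp: \<Phi>_def split: if_splits)
        with True eq have "u ((e x + f k) mod M) = u ((e y + f k) mod M)"
          by (auto simp: \<Phi>_def)
        then have "(f k + e x) mod M = (f k + e y) mod M"
          using inj_onD[OF u(1)] \<open>M > 0\<close> by (simp add: add.commute)
        then have "e x = e y"
          by (rule mod_add_left_cancel) (use True y e in auto)
        then show ?thesis
          using e(1) True y by (auto dest: inj_onD)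
      next
        case False
        with eq have "v x = v y"
          by (auto simp: \<Phi>_def split: if_splits)
        then show ?thesis
          using v(1) xy by (auto simp: X_def dest: inj_onD)
      qed
    qed
  qed (auto simp: \<Phi>_def)
  define R where "R = pair_pmf P Q"
  have R: "source_key_pmf n pX pK = R"
    by (simp add: R_def P_def Q_def source_key_pmf_def)
  have finR: "finite (set_pmf R)"
    using fin by (simp add: R_def)
  have intg: "integrable (measure_pmf R) (h :: _ \<Rightarrow> real)" for h
    by (rule integrable_measure_pmf_finite) (rule finR)
  define B where "B = - (T \<times> S)"
  have "measure_pmf.prob R B \<le> measure_pmf.prob R (fst -` (- T)) + measure_pmf.prob R (snd -` (- S))"
    by (rule order.trans[OF measure_pmf.finite_measure_mono measure_Un_le])
      (auto simp: B_def)
  also have "measure_pmf.prob R (fst -` (- T)) = measure_pmf.prob P (- T)"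
    by (simp add: R_def map_fst_pair_pmf flip: measure_map_pmf)
  also have "measure_pmf.prob R (snd -` (- S)) = measure_pmf.prob Q (- S)"
    by (simp add: R_def map_snd_pair_pmf flip: measure_map_pmf)
  finally have B: "measure_pmf.prob R B \<le> \<beta>"
    by (simp add: \<beta>_def P_def Q_def)
  \<comment> \<open>Length and leakage are both bounded by a constant plus a penalty paid only on
    the exceptional event \<open>B\<close>.\<close>
  have expB: "measure_pmf.expectation R (\<lambda>w. c + indicator B w * d) \<le> c + \<beta> * d" if "d \<ge> 0" for c d :: real
  proof -
    have "measure_pmf.expectation R (\<lambda>w. c + indicator B w * d) = c + measure_pmf.prob R B * d"
      by (subst Bochner_Integration.integral_add[OF intg intg]) simp
    with mult_right_mono[OF B that] show ?thesis
      by simp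
  qed
  have "avg_length n pX pK \<Phi> \<le> measure_pmf.expectation R
    (\<lambda>w. real (m + 1) + indicator B w * real (n * b + 1))"
    unfolding avg_length_def R
  proof (rule integral_mono_AE[OF intg intg])
    show "AE w in measure_pmf R. (case w of (x, k) \<Rightarrow> real (length (\<Phi> k x))) \<le>
      real (m + 1) + indicator B w * real (n * b + 1)"
      unfolding AE_measure_pmf_iff using vlen u(2) \<open>M > 0\<close>
      by (auto simp: R_def B_def \<Phi>_def indicator_def)
  qed
  also have "\<dots> \<le> real (m + 1) + \<beta> * real (n * b + 1)"
    by (rule expB) simp
  finally have len: "avg_length n pX pK \<Phi> \<le> real (m + 1) + \<beta> * real (n * b + 1)" .
  have leak: "leakage n pX pK \<Phi> \<le>
      log 2 (1 + 2 ^ m * \<tau>) + log 2 (1 / (1 - \<eta>)) + \<beta> * (real (n * b) + log 2 (1 / \<eta>))"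
    if \<eta>: "\<eta> \<in> {0<..<1}" for \<eta>
  proof -
    \<comment> \<open>A reference law for the ciphertext: mass \<open>1 - \<eta>\<close> uniform on
      the padded strings and mass \<eta> uniform on the clear ones, told apart by the flag bit. The
      share \<eta> keeps the log ratio finite on clear codewords.\<close>
    define G where "G c = (if hd c then \<eta> / 2 ^ (n * b) else (1 - \<eta>) / real M)" for c
    define J where "J = map_pmf (\<lambda>w. (case w of (x, k) \<Rightarrow> \<Phi> k x, case w of (x, k) \<Rightarrow> x)) R"
    \<comment> \<open>Given the source word, the ciphertext is random through the key alone. The
      factor \<open>pmf P x\<close> then cancels, and the leakage integrand is the log of a key
      probability over \<open>G\<close>.\<close>
    have J: "pmf J (c, x) = pmf P x * measure_pmf.prob Q {k. \<Phi> k x = c}" for c x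
    proof -
      have "(\<lambda>w. (case w of (x, k) \<Rightarrow> \<Phi> k x, case w of (x, k) \<Rightarrow> x)) -` {(c, x)} =
        {x} \<times> {k. \<Phi> k x = c}"
        by auto
      then show ?thesis
        by (simp add: J_def pmf_map R_def measure_pmf_prob_product measure_pmf_single)
    qed
    define \<alpha> where "\<alpha> = log 2 (1 + 2 ^ m * \<tau>) + log 2 (1 / (1 - \<eta>))"
    have \<tau>pos: "1 + 2 ^ m * \<tau> > 0"
      using S(3) by (auto intro: add_pos_nonneg)
    with S(3) \<eta> have "\<alpha> \<ge> 0"
      unfolding \<alpha>_def by (intro add_nonneg_nonneg) auto
    have V: "map_pmf (\<lambda>w. case w of (x, k) \<Rightarrow> x) R = P"
      by (simp add: R_def case_prod_unfold map_fst_pair_pmf)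
    have "leakage n pX pK \<Phi> \<le> measure_pmf.expectation R
      (\<lambda>w. log 2 (pmf J (case w of (x, k) \<Rightarrow> \<Phi> k x, case w of (x, k) \<Rightarrow> x) /
        (G (case w of (x, k) \<Rightarrow> \<Phi> k x) * pmf P (case w of (x, k) \<Rightarrow> x))))"
      unfolding leakage_def R J_def V[symmetric]
    proof (rule mutual_information_pmf_le[OF finR])
      show "G (case w of (x, k) \<Rightarrow> \<Phi> k x) > 0" for w
        using \<eta> \<open>M > 0\<close> by (auto simp: G_def split: prod.splits)
      have nonneg: "G c \<ge> 0" for c
        using \<eta> by (auto simp: G_def)
      have "sum G ((\<lambda>w. case w of (x, k) \<Rightarrow> \<Phi> k x) ` set_pmf R) \<le>
        sum G ((#) False ` {bs. length bs = m} \<union> (#) True ` {bs. length bs = n * b})"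
        using vlen u(2) \<open>M > 0\<close>
        by (intro sum_mono2) (auto simp: R_def \<Phi>_def nonneg finite_bool_lists)
      also have "\<dots> = sum G ((#) False ` {bs. length bs = m}) + sum G ((#) True ` {bs. length bs = n * b})"
        by (rule sum.union_disjoint) (auto simp: finite_bool_lists)
      also have "\<dots> = 1"
        by (subst (1 2) sum.reindex) (auto simp: G_def card_bool_lists M_def)
      finally show "sum G ((\<lambda>w. case w of (x, k) \<Rightarrow> \<Phi> k x) ` set_pmf R) \<le> 1" .
    qed
    also have "\<dots> \<le> measure_pmf.expectation R
      (\<lambda>w. \<alpha> + indicator B w * (real (n * b) + log 2 (1 / \<eta>)))"
    proof (rule integral_mono_AE[OF intg intg], unfold AE_measure_pmf_iff, clarsimp)
      fix x k assume "(x, k) \<in> set_pmf R"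
      then have xk: "x \<in> set_pmf P" "k \<in> set_pmf Q"
        by (auto simp: R_def)
      define pr where "pr = measure_pmf.prob Q {k'. \<Phi> k' x = \<Phi> k x}"
      have "pmf Q k \<le> pr"
        unfolding pr_def by (subst measure_pmf_single[symmetric]) (rule measure_pmf.finite_measure_mono, auto)
      with pmf_positive[OF xk(2)] have "pr > 0"
        by linarith
      have "pr \<le> 1"
        by (simp add: pr_def)
      have "pmf P x > 0"
        using xk by (simp add: pmf_positive)
      then have eq: "pmf J (\<Phi> k x, x) / (G (\<Phi> k x) * pmf P x) = pr / G (\<Phi> k x)"
        by (simp add: J pr_def)
      have "log 2 (pr / G (\<Phi> k x)) \<le> \<alpha> + indicator B (x, k) * (real (n * b) + log 2 (1 / \<eta>))"
      proof (cases "x \<in> T \<and> k \<in> S")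
        case True
        \<comment> \<open>With \<open>x\<close> fixed, keys giving the same padded ciphertext lie in
          one bin, whose mass is nearly \<open>1 / M\<close>; this is where balanced bins give
          secrecy.\<close>
        have "{k'. \<Phi> k' x = \<Phi> k x} \<subseteq> {k' \<in> S. f k' = f k}"
        proof clarify
          fix k' assume eq: "\<Phi> k' x = \<Phi> k x"
          with True have k': "k' \<in> S" "u ((e x + f k') mod M) = u ((e x + f k) mod M)"
            by (auto simp: \<Phi>_def split: if_splits)
          then have "(e x + f k') mod M = (e x + f k) mod M"
            using inj_onD[OF u(1)] \<open>M > 0\<close> by simp
          with k'(1) f(1) show "k' \<in> S \<and> f k' = f k"
            by (auto intro: mod_add_left_cancel)
        qed
        then have "pr \<le> measure_pmf.prob Q {k' \<in> S. f k' = f k}"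
          unfolding pr_def by (intro measure_pmf.finite_measure_mono) auto
        also have "\<dots> = sum (pmf Q) {k' \<in> S. f k' = f k}"
          by (rule measure_measure_pmf_finite) (use SX in auto)
        also have "\<dots> \<le> 1 / real M + \<tau>"
          by (rule f(2)[OF f(1)])
        finally have "pr / G (\<Phi> k x) \<le> (1 / real M + \<tau>) / G (\<Phi> k x)"
          using \<eta> by (intro divide_right_mono) (auto simp: G_def)
        also have "\<dots> = (1 + 2 ^ m * \<tau>) * (1 / (1 - \<eta>))"
          using True \<eta> by (simp add: G_def \<Phi>_def M_def field_simps)
        finally have "log 2 (pr / G (\<Phi> k x)) \<le> log 2 ((1 + 2 ^ m * \<tau>) * (1 / (1 - \<eta>)))"
          using \<open>pr > 0\<close> \<eta> by (intro log_mono) (auto simp: G_def M_def)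
        also have "\<dots> = \<alpha>"
          using \<eta> \<tau>pos unfolding \<alpha>_def by (intro log_mult_pos) auto
        finally show ?thesis
          using True by (simp add: B_def)
      next
        case False
        \<comment> \<open>In the clear case the key probability is bounded by 1; the resulting
          linear cost is charged to \<open>B\<close>.\<close>
        then have "pr / G (\<Phi> k x) \<le> 2 ^ (n * b) * (1 / \<eta>)"
          using \<eta> \<open>pr \<le> 1\<close> by (auto simp: G_def \<Phi>_def field_simps)
        then have "log 2 (pr / G (\<Phi> k x)) \<le> log 2 (2 ^ (n * b) * (1 / \<eta>))"
          using \<open>pr > 0\<close> \<eta> \<open>M > 0\<close> by (intro log_mono) (auto simp: G_def)
        also have "\<dots> = real (n * b) + log 2 (1 / \<eta>)"
          using \<eta> by (subst log_mult_pos) (auto simp: log_nat_power)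
        finally show ?thesis
          using False \<open>\<alpha> \<ge> 0\<close> by (auto simp: B_def)
      qed
      then show "log 2 (pmf J (\<Phi> k x, x) / (G (\<Phi> k x) * pmf P x)) \<le>
        \<alpha> + indicator B (x, k) * (real n * real b + log 2 (1 / \<eta>))"
        by (simp add: eq)
    qed
    also have "\<dots> \<le> \<alpha> + \<beta> * (real (n * b) + log 2 (1 / \<eta>))"
      using \<eta> by (intro expB) auto
    finally show ?thesis
      by (simp add: \<alpha>_def)
  qed
  from \<open>\<exists>\<Psi>. vl_scheme n \<Phi> \<Psi>\<close> len leak show ?thesis
    by blast
qed

section \<open>Typical sets of the source and the key\<close>

lemma shannon_entropy_nonneg: "shannon_entropy p \<ge> 0"
  unfolding shannon_entropy_eq_expectation
proof (rule integral_nonneg_AE, unfold AE_measure_pmf_iff, clarify)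
  fix x assume "x \<in> set_pmf p"
  then show "0 \<le> - log 2 (pmf p x)"
    by (simp add: pmf_positive pmf_le_1)
qed

text \<open>Words of probability above \<open>2 powr (- (n * h))\<close> number at most
  \<open>2 powr (n * h)\<close>, because their total mass is at most 1. The rest is a tail event for
  letter sums whose mean, entropy minus \<open>h\<close>, is negative.\<close>

lemma source_typical_set:
  fixes p :: "'a::finite pmf"
  assumes "h > shannon_entropy p"
  obtains r where "0 \<le> r" "r < 1"
    "\<And>n. \<exists>T. T \<subseteq> {x. length x = n} \<and> real (card T) \<le> 2 powr (real n * h) \<and>
      measure_pmf.prob (replicate_pmf n p) (- T) \<le> r ^ n"
proof -
  define f where "f a = - log 2 (pmf p a) - h" for a
  have "measure_pmf.expectation p f = shannon_entropy p - h"
    unfolding f_def shannon_entropy_eq_expectation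
    by (subst Bochner_Integration.integral_diff) (auto intro!: integrable_measure_pmf_finite)
  with assms have "measure_pmf.expectation p f < 0" by simp
  from chernoff_replicate_pmf[OF this] obtain r where r: "0 \<le> r" "r < 1"
    "\<And>n. measure_pmf.prob (replicate_pmf n p) {xs. sum_list (map f xs) \<ge> 0} \<le> r ^ n"
    by blast
  show ?thesis
  proof (rule that[OF r(1,2)])
    fix n
    define P where "P = replicate_pmf n p"
    \<comment> \<open>Restricting to the support loses no probability and makes the letter-sum
      formula for the log probability available.\<close>
    define T where "T = {x \<in> set_pmf P. sum_list (map f x) < 0}"
    have finT: "finite T"
      by (simp add: T_def P_def finite_set_replicate_pmf)
    have lenT: "T \<subseteq> {x. length x = n}"
      by (auto simp: T_def P_def set_replicate_pmf)
    have low: "2 powr (- (real n * h)) \<le> pmf P x" if "x \<in> T" for x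
    proof -
      have x: "x \<in> set_pmf P" "sum_list (map f x) < 0" "length x = n"
        using that lenT by (auto simp: T_def)
      have "sum_list (map f x) = - (\<Sum>a\<leftarrow>x. log 2 (pmf p a)) - real (length x) * h"
        unfolding f_def by (induction x) (simp_all add: algebra_simps)
      with x have "- (real n * h) < log 2 (pmf P x)"
        using log_pmf_replicate_pmf[of x n p] by (simp add: P_def)
      then show ?thesis
        using x(1) by (simp add: less_log_iff pmf_positive)
    qed
    have "real (card T) * 2 powr (- (real n * h)) = (\<Sum>x\<in>T. 2 powr (- (real n * h)))"
      by simp
    also have "\<dots> \<le> sum (pmf P) T"
      by (rule sum_mono) (rule low)
    also have "\<dots> \<le> 1"
      using finT by (simp flip: measure_measure_pmf_finite)
    finally have "real (card T) \<le> 2 powr (real n * h)"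
      by (simp add: powr_minus field_simps)
    moreover have "measure_pmf.prob P (- T) \<le> measure_pmf.prob P {xs. sum_list (map f xs) \<ge> 0}"
      by (rule measure_pmf.finite_measure_mono_AE) (auto simp: AE_measure_pmf_iff T_def)
    ultimately show "\<exists>T. T \<subseteq> {x. length x = n} \<and> real (card T) \<le> 2 powr (real n * h) \<and>
        measure_pmf.prob (replicate_pmf n p) (- T) \<le> r ^ n"
      using lenT r(3)[of n] by (intro exI[of _ T]) (auto simp: P_def)
  qed
qed

text \<open>The mirror image for \<open>h\<close> below the entropy: the letter function changes
  sign, and atypical words are those of too large a probability.\<close>

lemma key_typical_set:
  fixes p :: "'a::finite pmf"
  assumes "h < shannon_entropy p"
  obtains r where "0 \<le> r" "r < 1"
    "\<And>n. \<exists>S. S \<subseteq> {x. length x = n} \<and>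
      (\<forall>x\<in>S. pmf (replicate_pmf n p) x \<le> 2 powr (- (real n * h))) \<and>
      measure_pmf.prob (replicate_pmf n p) (- S) \<le> r ^ n"
proof -
  define f where "f a = log 2 (pmf p a) + h" for a
  have "measure_pmf.expectation p f = h - shannon_entropy p"
    unfolding f_def shannon_entropy_eq_expectation
    by (subst Bochner_Integration.integral_add) (auto intro!: integrable_measure_pmf_finite)
  with assms have "measure_pmf.expectation p f < 0" by simp
  from chernoff_replicate_pmf[OF this] obtain r where r: "0 \<le> r" "r < 1"
    "\<And>n. measure_pmf.prob (replicate_pmf n p) {xs. sum_list (map f xs) \<ge> 0} \<le> r ^ n"
    by blast
  show ?thesis
  proof (rule that[OF r(1,2)])
    fix n
    define P where "P = replicate_pmf n p"
    define S where "S = {x \<in> set_pmf P. sum_list (map f x) < 0}"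
    have lenS: "S \<subseteq> {x. length x = n}"
      by (auto simp: S_def P_def set_replicate_pmf)
    have "pmf P x \<le> 2 powr (- (real n * h))" if "x \<in> S" for x
    proof -
      have x: "x \<in> set_pmf P" "sum_list (map f x) < 0" "length x = n"
        using that lenS by (auto simp: S_def)
      have "sum_list (map f x) = (\<Sum>a\<leftarrow>x. log 2 (pmf p a)) + real (length x) * h"
        unfolding f_def by (induction x) (simp_all add: algebra_simps)
      with x have "log 2 (pmf P x) < - (real n * h)"
        using log_pmf_replicate_pmf[of x n p] by (simp add: P_def)
      then show ?thesis
        using x(1) by (simp add: log_less_iff pmf_positive)
    qed
    moreover have "measure_pmf.prob P (- S) \<le> measure_pmf.prob P {xs. sum_list (map f xs) \<ge> 0}"
      by (rule measure_pmf.finite_measure_mono_AE) (auto simp: AE_measure_pmf_iff S_def)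
    ultimately show "\<exists>S. S \<subseteq> {x. length x = n} \<and>
      (\<forall>x\<in>S. pmf (replicate_pmf n p) x \<le> 2 powr (- (real n * h))) \<and>
      measure_pmf.prob (replicate_pmf n p) (- S) \<le> r ^ n"
      using lenS r(3)[of n] by (intro exI[of _ S]) (auto simp: P_def)
  qed
qed

section \<open>Achievability: limits along the block length\<close>

lemma admissible_above_entropy:
  fixes pX pK :: "'a::finite pmf"
  assumes "\<delta> > 0" "shannon_entropy pX < R" "R < shannon_entropy pK"
  shows "admissible \<delta> pX pK R"
proof -
  \<comment> \<open>Half of the gap between \<open>R\<close> and the key entropy is spent on making
    each key's probability exponentially smaller than a bin's share.\<close>
  define \<kappa> where "\<kappa> = (shannon_entropy pK - R) / 2"
  have "\<kappa> > 0"
    using assms by (simp add: \<kappa>_def)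
  have "R > 0"
    using assms(2) shannon_entropy_nonneg[of pX] by simp
  obtain b where b: "CARD('a) \<le> 2 ^ b"
    using less_exp[of "CARD('a)"] less_imp_le by blast
  obtain r where r: "0 \<le> r" "r < 1"
    "\<And>n. \<exists>T. T \<subseteq> {x. length x = n} \<and> real (card T) \<le> 2 powr (real n * R) \<and>
      measure_pmf.prob (replicate_pmf n pX) (- T) \<le> r ^ n"
    by (rule source_typical_set[OF assms(2)]) blast
  have "R + \<kappa> < shannon_entropy pK"
    using assms by (simp add: \<kappa>_def field_simps)
  from key_typical_set[OF this] obtain s where s: "0 \<le> s" "s < 1"
    "\<And>n. \<exists>S. S \<subseteq> {x. length x = n} \<and>
      (\<forall>x\<in>S. pmf (replicate_pmf n pK) x \<le> 2 powr (- (real n * (R + \<kappa>)))) \<and>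
      measure_pmf.prob (replicate_pmf n pK) (- S) \<le> s ^ n"
    by blast
  \<comment> \<open>The summand 2 pays for the flag bit and for rounding \<open>n * R\<close> up to
    whole bits; the same rounding causes the factor 2 before the power in \<open>E\<close>
    below.\<close>
  define A where "A n = real n * R + 2 + (r ^ n + s ^ n) * real (n * b + 1)" for n
  define E where "E \<eta> n = log 2 (1 + 2 * 2 powr (- (real n * \<kappa>))) + log 2 (1 / (1 - \<eta>)) +
      (r ^ n + s ^ n) * (real (n * b) + log 2 (1 / \<eta>))" for \<eta> n
  have "\<exists>\<Phi> \<Psi>. vl_scheme n \<Phi> \<Psi> \<and> avg_length n pX pK \<Phi> \<le> A n \<and>
    (\<forall>\<eta>\<in>{0<..<1}. leakage n pX pK \<Phi> \<le> E \<eta> n)" for n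
  proof -
    obtain T where T: "T \<subseteq> {x. length x = n}" "real (card T) \<le> 2 powr (real n * R)"
      "measure_pmf.prob (replicate_pmf n pX) (- T) \<le> r ^ n"
      using r(3)[of n] by blast
    obtain S where S: "S \<subseteq> {x. length x = n}"
      "\<forall>x\<in>S. pmf (replicate_pmf n pK) x \<le> 2 powr (- (real n * (R + \<kappa>)))"
      "measure_pmf.prob (replicate_pmf n pK) (- S) \<le> s ^ n"
      using s(3)[of n] by blast
    define m where "m = nat \<lceil>real n * R\<rceil>"
    have "real m = real_of_int \<lceil>real n * R\<rceil>"
      using \<open>R > 0\<close> by (simp add: m_def)
    then have m: "real n * R \<le> real m" "real m \<le> real n * R + 1"
      by linarith+
    have "2 powr (real n * R) \<le> 2 powr real m"
      using m by (intro powr_mono) auto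
    also have "\<dots> = real (2 ^ m)"
      by (simp add: powr_realpow)
    finally have "real (card T) \<le> real (2 ^ m)"
      using T(2) by linarith
    then have "card T \<le> 2 ^ m"
      by (simp only: of_nat_le_iff)
    define \<beta> where "\<beta> = measure_pmf.prob (replicate_pmf n pX) (- T) + measure_pmf.prob (replicate_pmf n pK) (- S)"
    have \<beta>: "\<beta> \<le> r ^ n + s ^ n"
      using T(3) S(3) by (simp add: \<beta>_def)
    from ex_vl_scheme[OF T(1) \<open>card T \<le> 2 ^ m\<close> S(1,2) powr_ge_zero b, where pX = pX, folded \<beta>_def]
    obtain \<Phi> \<Psi> where scheme: "vl_scheme n \<Phi> \<Psi>"
      and len: "avg_length n pX pK \<Phi> \<le> real (m + 1) + \<beta> * real (n * b + 1)"
      and leak: "\<And>\<eta>. \<eta> \<in> {0<..<1} \<Longrightarrow> leakage n pX pK \<Phi> \<le>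
        log 2 (1 + 2 ^ m * 2 powr (- (real n * (R + \<kappa>)))) + log 2 (1 / (1 - \<eta>)) +
        \<beta> * (real (n * b) + log 2 (1 / \<eta>))"
      by blast
    have "avg_length n pX pK \<Phi> \<le> A n"
      unfolding A_def using m(2) by (intro order.trans[OF len] add_mono mult_right_mono \<beta>) auto
    moreover have "leakage n pX pK \<Phi> \<le> E \<eta> n" if "\<eta> \<in> {0<..<1}" for \<eta>
    proof -
      have "2 ^ m * 2 powr (- (real n * (R + \<kappa>))) = 2 powr (real m - real n * (R + \<kappa>))"
        by (simp flip: powr_realpow powr_add)
      also have "\<dots> \<le> 2 powr (1 - real n * \<kappa>)"
        using m(2) by (intro powr_mono) (auto simp: algebra_simps)
      also have "\<dots> = 2 * 2 powr (- (real n * \<kappa>))"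
        by (simp add: powr_diff powr_minus field_simps)
      finally have "log 2 (1 + 2 ^ m * 2 powr (- (real n * (R + \<kappa>)))) \<le>
        log 2 (1 + 2 * 2 powr (- (real n * \<kappa>)))"
        by (intro log_mono) (auto intro: add_pos_nonneg)
      moreover have "\<beta> * (real (n * b) + log 2 (1 / \<eta>)) \<le> (r ^ n + s ^ n) * (real (n * b) + log 2 (1 / \<eta>))"
        using that by (intro mult_right_mono \<beta> add_nonneg_nonneg) auto
      ultimately show ?thesis
        using leak[OF that] unfolding E_def by linarith
    qed
    ultimately show ?thesis
      using scheme by blast
  qed
  then obtain \<Phi> \<Psi> where scheme: "\<And>n. vl_scheme n (\<Phi> n) (\<Psi> n)"
    and len: "\<And>n. avg_length n pX pK (\<Phi> n) \<le> A n"
    and leak: "\<And>n \<eta>. \<eta> \<in> {0<..<1} \<Longrightarrow> leakage n pX pK (\<Phi> n) \<le> E \<eta> n"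
    by metis
  have "(\<lambda>n. r ^ n) \<longlonglongrightarrow> 0" "(\<lambda>n. s ^ n) \<longlonglongrightarrow> 0"
    using r s by (auto intro: LIMSEQ_realpow_zero)
  then have lim0: "(\<lambda>n. r ^ n + s ^ n) \<longlonglongrightarrow> 0"
    by (auto intro: tendsto_eq_intros)
  \<comment> \<open>The penalty of a clear transmission grows linearly in \<open>n\<close>, so the
    exceptional probability must vanish even after multiplication by \<open>n\<close>.\<close>
  have "(\<lambda>n. real n * r ^ n) \<longlonglongrightarrow> 0" "(\<lambda>n. real n * s ^ n) \<longlonglongrightarrow> 0"
    using r s by (auto intro!: powser_times_n_limit_0)
  then have "(\<lambda>n. real n * r ^ n + real n * s ^ n) \<longlonglongrightarrow> 0"
    by (auto intro: tendsto_eq_intros)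
  then have lim1: "(\<lambda>n. real n * (r ^ n + s ^ n)) \<longlonglongrightarrow> 0"
    by (simp add: distrib_left)
  have inv: "(\<lambda>n. 1 / real n) \<longlonglongrightarrow> 0"
    by (rule lim_1_over_n)
  have limA: "(\<lambda>n. 1 / real n * A n) \<longlonglongrightarrow> R"
  proof -
    have "(\<lambda>n. R + 2 * (1 / real n) + (r ^ n + s ^ n) * (real b + 1 / real n)) \<longlonglongrightarrow> R + 2 * 0 + 0 * (real b + 0)"
      by (intro tendsto_intros inv lim0)
    moreover have "\<forall>\<^sub>F n in sequentially.
      R + 2 * (1 / real n) + (r ^ n + s ^ n) * (real b + 1 / real n) = 1 / real n * A n"
      using eventually_gt_at_top[of 0] by eventually_elim (simp add: A_def field_simps)
    ultimately show ?thesis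
      by (simp add: tendsto_cong)
  qed
  \<comment> \<open>Chosen so that \<open>log 2 (1 / (1 - \<eta>))\<close> equals
    \<open>\<delta> / 2\<close>; the other terms of \<open>E\<close> vanish in the limit, leaving
    room below \<delta>.\<close>
  define \<eta> where "\<eta> = 1 - 2 powr (- \<delta> / 2)"
  have \<eta>: "\<eta> \<in> {0<..<1}"
    using assms(1) by (simp add: \<eta>_def powr_less_one)
  have log_eta: "log 2 (1 / (1 - \<eta>)) = \<delta> / 2"
    by (simp add: \<eta>_def log_divide)
  have "E \<eta> \<longlonglongrightarrow> log 2 (1 + 2 * 0) + log 2 (1 / (1 - \<eta>)) + (0 * real b + 0 * log 2 (1 / \<eta>))"
  proof -
    have "(\<lambda>n. (2 powr (- \<kappa>)) ^ n) \<longlonglongrightarrow> 0"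
      using \<open>\<kappa> > 0\<close> by (intro LIMSEQ_realpow_zero) (auto simp: powr_less_one)
    also have "(\<lambda>n. (2 powr (- \<kappa>)) ^ n) = (\<lambda>n. 2 powr (- (real n * \<kappa>)))"
      by (simp add: powr_power mult.commute)
    finally have "(\<lambda>n. 2 powr (- (real n * \<kappa>))) \<longlonglongrightarrow> 0" .
    then have "(\<lambda>n. log 2 (1 + 2 * 2 powr (- (real n * \<kappa>))) + log 2 (1 / (1 - \<eta>)) +
      (real n * (r ^ n + s ^ n) * real b + (r ^ n + s ^ n) * log 2 (1 / \<eta>)))
      \<longlonglongrightarrow> log 2 (1 + 2 * 0) + log 2 (1 / (1 - \<eta>)) + (0 * real b + 0 * log 2 (1 / \<eta>))"
      using \<eta> by (intro tendsto_intros lim0 lim1) auto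
    then show ?thesis
      by (simp add: E_def[abs_def] algebra_simps)
  qed
  then have limE: "E \<eta> \<longlonglongrightarrow> \<delta> / 2"
    by (simp add: log_eta)
  show ?thesis
    unfolding admissible_def
  proof (rule exI[of _ \<Phi>], rule exI[of _ \<Psi>], intro conjI allI impI)
    show "vl_scheme n (\<Phi> n) (\<Psi> n)" for n
      by (rule scheme)
    fix \<gamma> :: real assume "\<gamma> > 0"
    have "\<forall>\<^sub>F n in sequentially. 1 / real n * A n < R + \<gamma>"
      by (rule order_tendstoD(2)[OF limA]) (use \<open>\<gamma> > 0\<close> in simp)
    moreover have "\<forall>\<^sub>F n in sequentially. E \<eta> n < \<delta>"
      by (rule order_tendstoD(2)[OF limE]) (use assms(1) in simp)
    ultimately have "\<forall>\<^sub>F n in sequentially.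
      1 / real n * avg_length n pX pK (\<Phi> n) \<le> R + \<gamma> \<and> leakage n pX pK (\<Phi> n) \<le> \<delta>"
    proof eventually_elim
      case (elim n)
      have "1 / real n * avg_length n pX pK (\<Phi> n) \<le> 1 / real n * A n"
        by (intro mult_left_mono len) auto
      with elim leak[OF \<eta>, of n] show ?case
        by linarith
    qed
    then obtain N where N: "\<And>n. n \<ge> N \<Longrightarrow>
      1 / real n * avg_length n pX pK (\<Phi> n) \<le> R + \<gamma> \<and> leakage n pX pK (\<Phi> n) \<le> \<delta>"
      by (auto simp: eventually_sequentially)
    show "\<exists>n0\<ge>1. \<forall>n\<ge>n0. 1 / real n * avg_length n pX pK (\<Phi> n) \<le> R + \<gamma> \<and>
      leakage n pX pK (\<Phi> n) \<le> \<delta>"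
      by (rule exI[of _ "max 1 N"]) (use N in auto)
  qed
qed

section \<open>Identification of the optimal rates\<close>

lemma R_v_inf_delta_eq_entropy:
  fixes pX pK :: "'a::finite pmf"
  assumes "\<delta> > 0" "shannon_entropy pX < shannon_entropy pK"
  shows "R_v_inf_delta \<delta> pX pK = ereal (shannon_entropy pX)"
proof (rule antisym)
  show "ereal (shannon_entropy pX) \<le> R_v_inf_delta \<delta> pX pK"
    unfolding R_v_inf_delta_def by (auto intro!: Inf_greatest shannon_entropy_le_admissible)
  show "R_v_inf_delta \<delta> pX pK \<le> ereal (shannon_entropy pX)"
  proof (rule ereal_le_epsilon2)
    fix \<epsilon> :: real assume "\<epsilon> > 0"
    \<comment> \<open>The minimum keeps \<open>R\<close> strictly below the key entropy, as the
      achievability lemma requires, however large \<epsilon> is.\<close>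
    define R where "R = shannon_entropy pX + min \<epsilon> ((shannon_entropy pK - shannon_entropy pX) / 2)"
    have "shannon_entropy pX < R" "R < shannon_entropy pK"
      using assms(2) \<open>\<epsilon> > 0\<close> by (auto simp: R_def min_def field_simps)
    then have "admissible \<delta> pX pK R"
      by (rule admissible_above_entropy[OF assms(1)])
    then have "R_v_inf_delta \<delta> pX pK \<le> ereal R"
      unfolding R_v_inf_delta_def by (intro Inf_lower) auto
    also have "\<dots> \<le> ereal (shannon_entropy pX) + ereal \<epsilon>"
      by (simp add: R_def)
    finally show "R_v_inf_delta \<delta> pX pK \<le> ereal (shannon_entropy pX) + ereal \<epsilon>" .
  qed
qed

theorem theorem3:
  fixes pX pK :: "'a::{field,finite} pmf" and \<delta>0 :: real
  assumes "\<delta>0 > 0"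
    and "shannon_entropy pX < shannon_entropy pK"
  shows "(R_star pX pK = R_ast pX pK \<and> R_ast pX pK = ereal (shannon_entropy pX)) \<and>
    (\<forall>\<delta>\<in>{0<..\<delta>0}. R_v_inf \<delta>0 pX pK = R_v_inf_delta \<delta> pX pK \<and>
                    R_v_inf_delta \<delta> pX pK = ereal (shannon_entropy pX))"
proof -
  have eq: "R_v_inf_delta \<delta> pX pK = ereal (shannon_entropy pX)" if "\<delta> \<in> {0<..\<delta>0}" for \<delta>
    using that assms(2) by (intro R_v_inf_delta_eq_entropy) auto
  \<comment> \<open>A supremum of a constant, over an index set that is nonempty because \<delta>0
    is positive.\<close>
  have "R_v_inf \<delta>0 pX pK = ereal (shannon_entropy pX)"
    unfolding R_v_inf_def by (rule SUP_eq_const) (use assms(1) eq in auto)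
  with eq assms(2) show ?thesis
    by (auto simp: R_star_def R_ast_def)
qed

end
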